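(* Suppose that a linear partial monitoring game (with domain $\mathcal D$ and Legendre potential $F$ satisfying the standing assumptions in the context) has an $(\alpha,\beta,\lambda)$ adaptive information ratio. Then, for any $n\ge1$ and any finitely supported prior $\mu$ on $\mathcal Z^n$, there exists a policy such that $$\mathfrak{BR}_n\le n(\epsilon_{\mathcal D}+\alpha)+\operatorname{diam}(\mathcal D)^{1/\lambda}\left(\mathbb E\left[\sum_{t=1}^n\beta(Z_t,A_t)\right]\right)^{1-1/\lambda},$$ where $(Z_t)_{t=1}^n$ is sampled from $\mu$ and $(A_t)_{t=1}^n$ are the actions of that policy.
   Context: A linear partial monitoring game is given by an action set $\mathcal A\subset\mathbb R^d$, a signal set $\Sigma$, a latent set $\mathcal Z$, a signal function $\Phi:\mathcal A\times\mathcal Z\to\Sigma$, written $\Phi_a(z)$, and a loss function $\ell:\mathcal Z\to[0,1]^d$; $\Phi$ and $\ell$ are known to the learner. A policy $\pi$ maps action/signal sequences to distributions over $\mathcal A$. Given $(z_t)_{t=1}^n\in\mathcal Z^n$, in round $t$ the learner samples $A_t$ from the distribution $P_t$ given by $\pi$ from $(A_s)_{s<t}$, $(\sigma_s)_{s<t}$ and observes $\sigma_t=\Phi_{A_t}(z_t)$. The regret is $\mathfrak R_n(\pi,(z_t))=\max_{a\in\mathcal A}\mathbb E[\sum_{t=1}^n\langle A_t-a,\ell(z_t)\rangle]$ and the Bayesian regret is $\mathfrak{BR}_n=\mathfrak{BR}_n(\pi,\mu)=\int_{\mathcal Z^n}\mathfrak R_n(\pi,(z_t))\,d\mu((z_t))$.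 Standing assumptions. $F:\mathbb R^d\to\mathbb R\cup\{\infty\}$ is Legendre (proper, convex, lower semi-continuous, essentially smooth and essentially strictly convex). $\mathcal D\subset\operatorname{conv}(\mathcal A)$ is compact, convex and has non-empty relative interior. Moreover: (a) $1<|\mathcal A|<\infty$; (b) $\langle a,\ell(z)\rangle\in[0,1]$ for all $a\in\mathcal A$, $z\in\mathcal Z$; (c) $\mathcal D\subset\operatorname{dom}(F)=\{x:F(x)<\infty\}$; (d) $\operatorname{diam}(\mathcal D)=\sup_{x,y\in\mathcal D}(F(x)-F(y))<\infty$. Notation. $\mathcal P$ is the set of probability distributions on $\mathcal A$. $\operatorname{D}(p,q)=F(p)-F(q)-\langle\nabla F(q),p-q\rangle$ is the Bregman divergence; if $F$ is not differentiable at $q$, then $\langle\nabla F(q),p-q\rangle$ is read as the one-sided directional derivative $\lim_{h\to0^+}(F(q+h(p-q))-F(q))/h$. $\mathcal V$ is the set of finitely supported probability distributions on $\mathcal Z\times\mathcal D$. $\epsilon_{\mathcal D}=\max_{a\in\mathcal A}\min_{b\in\mathcal D}\sup_{z\in\mathcal Z}\langle b-a,\ell(z)\rangle$. Adaptive information ratio. Let $\alpha\in\mathbb R$, $\beta:\mathcal Z\times\mathcal A\to[0,\infty)$ and $\lambda>1$. The game has an $(\alpha,\beta,\lambda)$ adaptive information ratio if for all $\nu\in\mathcal V$ there exists $p\in\mathcal P$ such that when $(Z,A^*,A)$ has law $\nu\otimes p$ (i.e. $(Z,A^* )\sim\nu$ and $A\sim p$ independently), $$\mathbb E[\langle A-A^*,\ell(Z)\rangle]\le\alpha+\big(\mathbb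 E[\beta(Z,A)]\big)^{1-1/\lambda}\,\big(\mathbb E[\operatorname{D}(\mathbb E[A^*\mid\Phi_A(Z),A],\mathbb E[A^*])]\big)^{1/\lambda}.$$ *)

theory Defs
  imports "HOL-Probability.Probability"
begin

section \<open>Legendre functions with values in the reals extended by plus infinity\<close>

definition dom_of :: "('a \<Rightarrow> ereal) \<Rightarrow> 'a set" where
  "dom_of F = {x. F x < \<infinity>}"

text \<open>
  The conditions below follow Rockafellar, \<^emph>\<open>Convex Analysis\<close>. Convexity is convexity of the
  epigraph.
\<close>

definition proper_fun :: "('a \<Rightarrow> ereal) \<Rightarrow> bool" where
  "proper_fun F \<longleftrightarrow> (\<forall>x. F x \<noteq> -\<infinity>) \<and> dom_of F \<noteq> {}"

definition convex_fun :: "('a::real_vector \<Rightarrow> ereal) \<Rightarrow> bool" where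
  "convex_fun F \<longleftrightarrow> convex {(x, r :: real). F x \<le> ereal r}"

definition lsc_fun :: "('a::topological_space \<Rightarrow> ereal) \<Rightarrow> bool" where
  "lsc_fun F \<longleftrightarrow> (\<forall>x. F x \<le> Liminf (at x) F)"

text \<open>
  Differentiability is only meaningful in the interior of the domain: outside the domain
  \<^const>\<open>real_of_ereal\<close> sends infinity to 0, so differentiability of the composition alone
  would say nothing there.
\<close>

definition has_grad :: "('a::euclidean_space \<Rightarrow> ereal) \<Rightarrow> 'a \<Rightarrow> 'a \<Rightarrow> bool" where
  "has_grad F x g \<longleftrightarrow> x \<in> interior (dom_of F) \<and> (GDERIV (\<lambda>y. real_of_ereal (F y)) x :> g)"

definition grad :: "('a::euclidean_space \<Rightarrow> ereal) \<Rightarrow> 'a \<Rightarrow> 'a" where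
  "grad F x = (THE g. has_grad F x g)"

definition essentially_smooth :: "('a::euclidean_space \<Rightarrow> ereal) \<Rightarrow> bool" where
  "essentially_smooth F \<longleftrightarrow>
     interior (dom_of F) \<noteq> {} \<and>
     (\<forall>x\<in>interior (dom_of F). \<exists>g. has_grad F x g) \<and>
     (\<forall>X x. (\<forall>k. X k \<in> interior (dom_of F)) \<longrightarrow> X \<longlonglongrightarrow> x \<longrightarrow>
        x \<in> frontier (interior (dom_of F)) \<longrightarrow>
        filterlim (\<lambda>k::nat. norm (grad F (X k))) at_top sequentially)"

definition subdiff :: "('a::euclidean_space \<Rightarrow> ereal) \<Rightarrow> 'a \<Rightarrow> 'a set" where
  "subdiff F x = {g. \<forall>y. F x + ereal (inner g (y - x)) \<le> F y}"

definition strictly_convex_fun_on :: "'a::real_vector set \<Rightarrow> ('a \<Rightarrow> ereal) \<Rightarrow> bool" where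
  "strictly_convex_fun_on S F \<longleftrightarrow>
     (\<forall>x\<in>S. \<forall>y\<in>S. \<forall>t. x \<noteq> y \<longrightarrow> 0 < t \<longrightarrow> t < 1 \<longrightarrow>
        F ((1 - t) *\<^sub>R x + t *\<^sub>R y) < ereal (1 - t) * F x + ereal t * F y)"

definition essentially_strictly_convex :: "('a::euclidean_space \<Rightarrow> ereal) \<Rightarrow> bool" where
  "essentially_strictly_convex F \<longleftrightarrow>
     (\<forall>S. convex S \<and> S \<subseteq> {x. subdiff F x \<noteq> {}} \<longrightarrow> strictly_convex_fun_on S F)"

definition legendre :: "('a::euclidean_space \<Rightarrow> ereal) \<Rightarrow> bool" where
  "legendre F \<longleftrightarrow> proper_fun F \<and> convex_fun F \<and> lsc_fun F \<and>
     essentially_smooth F \<and> essentially_strictly_convex F"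

text \<open>
  The one-sided directional derivative at \<open>q\<close> in direction \<open>v\<close>, a limit in the extended reals;
  it is used with \<open>q\<close> in the domain of \<open>F\<close>, where it exists by convexity and may be minus
  infinity.
\<close>

definition dir_deriv :: "('a::euclidean_space \<Rightarrow> ereal) \<Rightarrow> 'a \<Rightarrow> 'a \<Rightarrow> ereal" where
  "dir_deriv F q v = Lim (at_right (0::real)) (\<lambda>h. (F (q + h *\<^sub>R v) - F q) / ereal h)"

definition bregman :: "('a::euclidean_space \<Rightarrow> ereal) \<Rightarrow> 'a \<Rightarrow> 'a \<Rightarrow> ereal" where
  "bregman F p q = F p - F q -
     (if \<exists>g. has_grad F q g then ereal (inner (grad F q) (p - q)) else dir_deriv F q (p - q))"

definition pot_diam :: "('a \<Rightarrow> ereal) \<Rightarrow> 'a set \<Rightarrow> ereal" where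
  "pot_diam F D = (SUP x\<in>D. SUP y\<in>D. F x - F y)"


section \<open>Linear partial monitoring\<close>

text \<open>
  A policy maps a history of action/signal pairs, oldest first, to a distribution over actions.
  Latent sequences are lists, so that \<open>latent_seqs Z n\<close> is the \<open>n\<close>-fold power of \<open>Z\<close>.
\<close>

type_synonym ('a, 's) policy = "('a \<times> 's) list \<Rightarrow> 'a pmf"

definition is_policy :: "'a set \<Rightarrow> 's set \<Rightarrow> ('a, 's) policy \<Rightarrow> bool" where
  "is_policy A \<Sigma> \<pi> \<longleftrightarrow> (\<forall>h\<in>lists (A \<times> \<Sigma>). set_pmf (\<pi> h) \<subseteq> A)"

definition latent_seqs :: "'z set \<Rightarrow> nat \<Rightarrow> 'z list set" where
  "latent_seqs Z n = {zs. length zs = n \<and> set zs \<subseteq> Z}"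

text \<open>\<open>play_from \<Phi> \<pi> h zs\<close> is the law of the full history when play continues from the history
  \<open>h\<close> against the latent sequence \<open>zs\<close>.\<close>

primrec play_from ::
  "('a \<Rightarrow> 'z \<Rightarrow> 's) \<Rightarrow> ('a, 's) policy \<Rightarrow> ('a \<times> 's) list \<Rightarrow> 'z list \<Rightarrow> ('a \<times> 's) list pmf" where
  "play_from \<Phi> \<pi> h [] = return_pmf h"
| "play_from \<Phi> \<pi> h (z # zs) = bind_pmf (\<pi> h) (\<lambda>a. play_from \<Phi> \<pi> (h @ [(a, \<Phi> a z)]) zs)"

definition actions_law :: "('a \<Rightarrow> 'z \<Rightarrow> 's) \<Rightarrow> ('a, 's) policy \<Rightarrow> 'z list \<Rightarrow> 'a list pmf" where
  "actions_law \<Phi> \<pi> zs = map_pmf (map fst) (play_from \<Phi> \<pi> [] zs)"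

definition regret ::
  "'a::euclidean_space set \<Rightarrow> ('a \<Rightarrow> 'z \<Rightarrow> 's) \<Rightarrow> ('z \<Rightarrow> 'a) \<Rightarrow> ('a, 's) policy \<Rightarrow> 'z list \<Rightarrow> real" where
  "regret A \<Phi> loss \<pi> zs =
     (MAX a\<in>A. measure_pmf.expectation (actions_law \<Phi> \<pi> zs)
        (\<lambda>as. \<Sum>t<length zs. inner (as ! t - a) (loss (zs ! t))))"

definition bayes_regret ::
  "'a::euclidean_space set \<Rightarrow> ('a \<Rightarrow> 'z \<Rightarrow> 's) \<Rightarrow> ('z \<Rightarrow> 'a) \<Rightarrow> ('a, 's) policy \<Rightarrow> 'z list pmf \<Rightarrow> real" where
  "bayes_regret A \<Phi> loss \<pi> \<mu> = measure_pmf.expectation \<mu> (regret A \<Phi> loss \<pi>)"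

definition joint_law ::
  "('a \<Rightarrow> 'z \<Rightarrow> 's) \<Rightarrow> ('a, 's) policy \<Rightarrow> 'z list pmf \<Rightarrow> ('z list \<times> 'a list) pmf" where
  "joint_law \<Phi> \<pi> \<mu> = bind_pmf \<mu> (\<lambda>zs. map_pmf (\<lambda>as. (zs, as)) (actions_law \<Phi> \<pi> zs))"

text \<open>
  The infimum over \<open>D\<close> is a minimum for compact non-empty \<open>D\<close> and bounded losses, since the
  inner supremum is then a Lipschitz function of \<open>b\<close>.
\<close>

definition approx_err :: "'a::euclidean_space set \<Rightarrow> 'z set \<Rightarrow> ('z \<Rightarrow> 'a) \<Rightarrow> 'a set \<Rightarrow> real" where
  "approx_err A Z loss D = (MAX a\<in>A. INF b\<in>D. SUP z\<in>Z. inner (b - a) (loss z))"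


section \<open>The adaptive information ratio\<close>

text \<open>Expectation of an extended-real random variable under a finitely supported law.\<close>

definition expect_ereal :: "'b pmf \<Rightarrow> ('b \<Rightarrow> ereal) \<Rightarrow> ereal" where
  "expect_ereal M f = (\<Sum>\<omega>\<in>set_pmf M. ereal (pmf M \<omega>) * f \<omega>)"

definition ereal_powr :: "ereal \<Rightarrow> real \<Rightarrow> ereal" where
  "ereal_powr x r = (if x = \<infinity> then \<infinity> else ereal (real_of_ereal x powr r))"

text \<open>
  \<open>posterior_mean \<Phi> \<nu> p a s\<close> is the conditional expectation of the target given that the action
  is \<open>a\<close> and the signal is \<open>s\<close>, under the product law of \<open>\<nu>\<close> and \<open>p\<close>. The law is discrete, so
  this is conditioning on an event, which has positive probability for every \<open>(a, s)\<close> that occurs.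
\<close>

definition posterior_mean ::
  "('a::euclidean_space \<Rightarrow> 'z \<Rightarrow> 's) \<Rightarrow> ('z \<times> 'a) pmf \<Rightarrow> 'a pmf \<Rightarrow> 'a \<Rightarrow> 's \<Rightarrow> 'a" where
  "posterior_mean \<Phi> \<nu> p a s =
     measure_pmf.expectation
       (cond_pmf (pair_pmf \<nu> p) {((z, b), a'). a' = a \<and> \<Phi> a' z = s})
       (\<lambda>((z, b), a'). b)"

definition expected_gain ::
  "('a::euclidean_space \<Rightarrow> ereal) \<Rightarrow> ('a \<Rightarrow> 'z \<Rightarrow> 's) \<Rightarrow> ('z \<times> 'a) pmf \<Rightarrow> 'a pmf \<Rightarrow> ereal" where
  "expected_gain F \<Phi> \<nu> p =
     expect_ereal (pair_pmf \<nu> p)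
       (\<lambda>((z, b), a). bregman F (posterior_mean \<Phi> \<nu> p a (\<Phi> a z)) (measure_pmf.expectation \<nu> snd))"

text \<open>
  The expected divergence is non-negative but a priori extended-real; the inequality is therefore
  stated in the extended reals.
\<close>

definition adaptive_info_ratio ::
  "'a::euclidean_space set \<Rightarrow> 'z set \<Rightarrow> ('a \<Rightarrow> 'z \<Rightarrow> 's) \<Rightarrow> ('z \<Rightarrow> 'a) \<Rightarrow> 'a set \<Rightarrow> ('a \<Rightarrow> ereal) \<Rightarrow>
   real \<Rightarrow> ('z \<Rightarrow> 'a \<Rightarrow> real) \<Rightarrow> real \<Rightarrow> bool" where
  "adaptive_info_ratio A Z \<Phi> loss D F \<alpha> \<beta> lam \<longleftrightarrow>
     (\<forall>\<nu>. finite (set_pmf \<nu>) \<and> set_pmf \<nu> \<subseteq> Z \<times> D \<longrightarrow>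
       (\<exists>p. set_pmf p \<subseteq> A \<and>
         ereal (measure_pmf.expectation (pair_pmf \<nu> p) (\<lambda>((z, b), a). inner (a - b) (loss z)))
         \<le> ereal \<alpha> +
           ereal (measure_pmf.expectation (pair_pmf \<nu> p) (\<lambda>((z, b), a). \<beta> z a) powr (1 - 1 / lam)) *
           ereal_powr (expected_gain F \<Phi> \<nu> p) (1 / lam)))"

end

(* Play against the posterior: by induction on the number k of remaining rounds, any joint law of a
   latent sequence and a comparator b in D admits a policy whose regret against b is at most
     k * \<alpha> + (E sum \<beta>)^(1 - 1/lam) * (M - F(E b))^(1/lam),
   where M bounds F on D from above. The first action comes from the information ratio; after it, the
   policy for the posterior given action and signal takes over. The expected divergence between the
   posterior and the prior mean is at most E F(posterior mean) - F(prior mean), which telescopes with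
   the potential gap M - F(E b), and Hoelder's inequality merges the bound for the first round with
   those for the posteriors. Replacing the best action in hindsight by its approximation in D costs
   the approximation error in every round. *)

theory Submission
  imports Defs
begin

section \<open>Finitely supported distributions\<close>

lemma expectation_finite_pmf:
  fixes f :: "'a \<Rightarrow> 'b::euclidean_space"
  assumes "finite (set_pmf M)"
  shows "measure_pmf.expectation M f = (\<Sum>x\<in>set_pmf M. pmf M x *\<^sub>R f x)"
  using assms by (intro integral_measure_pmf) auto

lemma expectation_bind_finite_pmf:
  fixes h :: "'b \<Rightarrow> 'c::euclidean_space"
  assumes "finite (set_pmf p)" "\<And>x. x \<in> set_pmf p \<Longrightarrow> finite (set_pmf (f x))"
  shows "measure_pmf.expectation (bind_pmf p f) h =
    measure_pmf.expectation p (\<lambda>x. measure_pmf.expectation (f x) h)"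
  using assms by (simp add: pmf_expectation_bind[of "set_pmf p"] expectation_finite_pmf[of p])

lemma expectation_pair_finite_pmf:
  fixes h :: "'a \<times> 'b \<Rightarrow> 'c::euclidean_space"
  assumes "finite (set_pmf p)" "finite (set_pmf q)"
  shows "measure_pmf.expectation (pair_pmf p q) h =
    measure_pmf.expectation p (\<lambda>x. measure_pmf.expectation q (\<lambda>y. h (x, y)))"
proof -
  have "pair_pmf p q = bind_pmf p (\<lambda>x. map_pmf (Pair x) q)"
    by (simp add: pair_pmf_def map_pmf_def)
  then show ?thesis
    using assms by (simp add: expectation_bind_finite_pmf)
qed

lemma expectation_cong_pmf:
  assumes "\<And>x. x \<in> set_pmf M \<Longrightarrow> f x = g x"
  shows "measure_pmf.expectation M f = measure_pmf.expectation M g"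
  using assms by (intro integral_cong_AE) (auto simp: AE_measure_pmf_iff)

lemma expectation_mono_pmf:
  fixes f g :: "'a \<Rightarrow> real"
  assumes "finite (set_pmf M)" "\<And>x. x \<in> set_pmf M \<Longrightarrow> f x \<le> g x"
  shows "measure_pmf.expectation M f \<le> measure_pmf.expectation M g"
  using assms
  by (intro integral_mono_AE) (auto simp: AE_measure_pmf_iff integrable_measure_pmf_finite)

lemma expectation_nonneg_pmf:
  fixes f :: "'a \<Rightarrow> real"
  assumes "\<And>x. x \<in> set_pmf M \<Longrightarrow> 0 \<le> f x"
  shows "0 \<le> measure_pmf.expectation M f"
  using assms by (intro integral_nonneg_AE) (auto simp: AE_measure_pmf_iff)

lemma expectation_in_convex_pmf:
  fixes f :: "'a \<Rightarrow> 'b::euclidean_space"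
  assumes "finite (set_pmf M)" "convex C" "\<And>x. x \<in> set_pmf M \<Longrightarrow> f x \<in> C"
  shows "measure_pmf.expectation M f \<in> C"
  using assms by (simp add: expectation_finite_pmf convex_sum sum_pmf_eq_1)

lemma jensen_pmf:
  fixes X :: "'a \<Rightarrow> 'b::euclidean_space"
  assumes "finite (set_pmf M)" "convex_on C f" "\<And>x. x \<in> set_pmf M \<Longrightarrow> X x \<in> C"
  shows "f (measure_pmf.expectation M X) \<le> measure_pmf.expectation M (\<lambda>x. f (X x))"
  using assms
  by (simp add: expectation_finite_pmf convex_on_sum sum_pmf_eq_1 set_pmf_not_empty)

text \<open>Tower property. Drawing a value of \<open>g\<close> and then conditioning on it recovers
  \<open>Q\<close>, so the averaged conditional expectations are the plain one.\<close>

lemma expectation_cond_pmf: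
  fixes f :: "'a \<Rightarrow> 'c::euclidean_space"
  assumes "finite (set_pmf Q)"
  shows "measure_pmf.expectation (map_pmf g Q) (\<lambda>s. measure_pmf.expectation (cond_pmf Q {x. g x = s}) f) =
    measure_pmf.expectation Q f"
proof -
  have ne: "set_pmf Q \<inter> {x. g x = s} \<noteq> {}" if "s \<in> set_pmf (map_pmf g Q)" for s
    using that by auto
  have "bind_pmf (map_pmf g Q) (\<lambda>s. cond_pmf Q {x. g x = s}) = Q"
  proof (rule bind_cond_pmf_cancel)
    fix x y assume "g y = x"
    have "measure_pmf.prob (map_pmf g Q) {s. g y = s} = measure_pmf.prob Q (g -` {s. g y = s})"
      by (rule measure_map_pmf)
    also have "g -` {s. g y = s} = {z. g z = x}"
      using \<open>g y = x\<close> by auto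
    finally show "measure_pmf.prob Q {y. g y = x} = measure_pmf.prob (map_pmf g Q) {s. g y = s}" ..
  qed (use ne in \<open>auto\<close>)
  moreover have "measure_pmf.expectation (bind_pmf (map_pmf g Q) (\<lambda>s. cond_pmf Q {x. g x = s})) f =
    measure_pmf.expectation (map_pmf g Q) (\<lambda>s. measure_pmf.expectation (cond_pmf Q {x. g x = s}) f)"
    using assms ne by (intro expectation_bind_finite_pmf) (auto simp: set_cond_pmf)
  ultimately show ?thesis by simp
qed

section \<open>Hoelder's inequality with an additional term\<close>

text \<open>Young's inequality for the ratios \<open>x / X\<close> and \<open>y / Y\<close>, scaled
  back. In this form the right-hand side is linear in \<open>x\<close> and \<open>y\<close>, so it
  can be averaged.\<close>

lemma weighted_AM_GM_powr:
  fixes x y X Y s :: real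
  assumes "0 \<le> x" "0 \<le> y" "0 < X" "0 < Y" "0 < s" "s < 1"
  shows "x powr (1 - s) * y powr s \<le> X powr (1 - s) * Y powr s * ((1 - s) * (x / X) + s * (y / Y))"
proof (cases "x = 0 \<or> y = 0")
  case True
  then show ?thesis using assms by auto
next
  case False
  then have "(x / X) powr (1 - s) * (y / Y) powr s \<le> (1 - s) * (x / X) + s * (y / Y)"
    using assms by (intro Youngs_inequality_0) auto
  then have "X powr (1 - s) * Y powr s * ((x / X) powr (1 - s) * (y / Y) powr s) \<le>
    X powr (1 - s) * Y powr s * ((1 - s) * (x / X) + s * (y / Y))"
    by (intro mult_left_mono) auto
  then show ?thesis
    using assms by (simp add: powr_divide)
qed

text \<open>Hoelder's inequality for the measure \<open>L\<close> enlarged by one atom that carries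
  \<open>b\<close> and \<open>c\<close>. Every product is bounded by the weighted AM-GM inequality,
  normalised by the totals \<open>X\<close> and \<open>Y\<close>; the linear bounds then add up to
  \<open>X powr (1 - s) * Y powr s\<close>, since the weights \<open>1 - s\<close> and
  \<open>s\<close> sum to 1.\<close>

lemma Hoelder_add_pmf:
  fixes B C :: "'a \<Rightarrow> real" and s b c :: real
  assumes fin: "finite (set_pmf L)" and s: "0 < s" "s < 1" and "0 \<le> b" "0 \<le> c"
    and B: "\<And>x. x \<in> set_pmf L \<Longrightarrow> 0 \<le> B x" and C: "\<And>x. x \<in> set_pmf L \<Longrightarrow> 0 \<le> C x"
  shows "b powr (1 - s) * c powr s + measure_pmf.expectation L (\<lambda>x. B x powr (1 - s) * C x powr s)
    \<le> (b + measure_pmf.expectation L B) powr (1 - s) * (c + measure_pmf.expectation L C) powr s"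
proof -
  note integ = integrable_measure_pmf_finite[OF fin]
  define X where "X = b + measure_pmf.expectation L B"
  define Y where "Y = c + measure_pmf.expectation L C"
  have EB: "0 \<le> measure_pmf.expectation L B" and EC: "0 \<le> measure_pmf.expectation L C"
    using B C by (auto intro: expectation_nonneg_pmf)
  have zero: "\<forall>x\<in>set_pmf L. f x = 0"
    if "measure_pmf.expectation L f = 0" "\<And>x. x \<in> set_pmf L \<Longrightarrow> 0 \<le> f x" for f :: "'a \<Rightarrow> real"
    using that integral_nonneg_eq_0_iff_AE[of L f] integ by (auto simp: AE_measure_pmf_iff)
  \<comment> \<open>The normalisation divides by both totals. If one of them is zero, all its
    non-negative terms are zero, and with \<open>0 powr r = 0\<close> the left-hand side
    vanishes.\<close>
  consider "X = 0" | "Y = 0" | "0 < X" "0 < Y"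
    unfolding X_def Y_def using EB EC assms by linarith
  then show ?thesis
  proof cases
    case 1
    then have "b = 0" and "\<forall>x\<in>set_pmf L. B x = 0"
      using EB \<open>0 \<le> b\<close> zero[of B] B by (auto simp: X_def add_nonneg_eq_0_iff)
    then have "measure_pmf.expectation L (\<lambda>x. B x powr (1 - s) * C x powr s) = measure_pmf.expectation L (\<lambda>_. 0)"
      by (intro expectation_cong_pmf) auto
    then show ?thesis using \<open>b = 0\<close> by simp
  next
    case 2
    then have "c = 0" and "\<forall>x\<in>set_pmf L. C x = 0"
      using EC \<open>0 \<le> c\<close> zero[of C] C by (auto simp: Y_def add_nonneg_eq_0_iff)
    then have "measure_pmf.expectation L (\<lambda>x. B x powr (1 - s) * C x powr s) = measure_pmf.expectation L (\<lambda>_. 0)"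
      by (intro expectation_cong_pmf) auto
    then show ?thesis using \<open>c = 0\<close> by simp
  next
    case 3
    define K where "K = X powr (1 - s) * Y powr s"
    have "b powr (1 - s) * c powr s \<le> K * ((1 - s) * (b / X) + s * (c / Y))"
      unfolding K_def using assms 3 by (intro weighted_AM_GM_powr)
    moreover have "measure_pmf.expectation L (\<lambda>x. B x powr (1 - s) * C x powr s) \<le>
        measure_pmf.expectation L (\<lambda>x. K * ((1 - s) * (B x / X) + s * (C x / Y)))"
      unfolding K_def using assms 3 by (intro expectation_mono_pmf weighted_AM_GM_powr) auto
    moreover have "measure_pmf.expectation L (\<lambda>x. K * ((1 - s) * (B x / X) + s * (C x / Y))) =
        K * ((1 - s) * (measure_pmf.expectation L B / X) + s * (measure_pmf.expectation L C / Y))"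
      using fin by (simp add: expectation_finite_pmf sum.distrib sum_distrib_left sum_divide_distrib algebra_simps)
    moreover have "K * ((1 - s) * (b / X) + s * (c / Y)) +
        K * ((1 - s) * (measure_pmf.expectation L B / X) + s * (measure_pmf.expectation L C / Y)) =
        K * ((1 - s) * (X / X) + s * (Y / Y))"
    proof -
      have "X / X = b / X + measure_pmf.expectation L B / X" "Y / Y = c / Y + measure_pmf.expectation L C / Y"
        by (simp_all add: X_def Y_def flip: add_divide_distrib)
      then show ?thesis by (simp only: distrib_left add_ac)
    qed
    moreover have "K * ((1 - s) * (X / X) + s * (Y / Y)) = K"
      using 3 by simp
    ultimately show ?thesis
      unfolding K_def X_def Y_def by linarith
  qed
qed


section \<open>Bregman divergences at a mean\<close>

lemma convex_fun_imp_convex_on: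
  assumes F: "convex_fun F" and D: "convex D" and f: "\<And>x. x \<in> D \<Longrightarrow> F x = ereal (f x)"
  shows "convex_on D f"
proof (rule convex_onI)
  fix t x y assume t: "0 < t" "t < (1::real)" and xy: "x \<in> D" "y \<in> D"
  let ?z = "(1 - t) *\<^sub>R x + t *\<^sub>R y"
  have "(1 - t) *\<^sub>R (x, f x) + t *\<^sub>R (y, f y) \<in> {(x, r). F x \<le> ereal r}"
    using F t xy f unfolding convex_fun_def by (intro convexD) auto
  then have "F ?z \<le> ereal ((1 - t) * f x + t * f y)" by simp
  moreover have "?z \<in> D" using D t xy by (intro convexD) auto
  ultimately show "f ?z \<le> (1 - t) * f x + t * f y" using f by simp
qed (rule D)

text \<open>The nearer point is the convex combination of \<open>q\<close> and the farther point
  with weight \<open>h / h'\<close>.\<close>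

lemma convex_on_slope_mono:
  fixes f :: "'a::real_vector \<Rightarrow> real"
  assumes f: "convex_on D f" and q: "q \<in> D" and x: "q + h' *\<^sub>R v \<in> D" and h: "0 < h" "h \<le> h'"
  shows "(f (q + h *\<^sub>R v) - f q) / h \<le> (f (q + h' *\<^sub>R v) - f q) / h'"
proof -
  define t where "t = h / h'"
  have t: "0 \<le> t" "t \<le> 1" "t * h' = h" and "0 < h'" using h by (auto simp: t_def)
  have "(1 - t) *\<^sub>R q + t *\<^sub>R (q + h' *\<^sub>R v) = q + (t * h') *\<^sub>R v"
    by (simp add: algebra_simps)
  then have "f (q + h *\<^sub>R v) \<le> (1 - t) * f q + t * f (q + h' *\<^sub>R v)"
    using convex_onD[OF f t(1,2) q x] t by simp
  then have "f (q + h *\<^sub>R v) - f q \<le> t * (f (q + h' *\<^sub>R v) - f q)"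
    by (simp add: algebra_simps)
  then show ?thesis
    using h \<open>0 < h'\<close> by (simp add: t_def field_simps)
qed

text \<open>Monotonicity is only asked for up to 1: the difference quotients are controlled on the
  segment from the mean to a point of \<open>D\<close>, which corresponds to steps in (0,
  1].\<close>

lemma mono_tendsto_at_right_INF:
  fixes \<phi> :: "real \<Rightarrow> real"
  assumes mono: "\<And>h h'. 0 < h \<Longrightarrow> h \<le> h' \<Longrightarrow> h' \<le> 1 \<Longrightarrow> \<phi> h \<le> \<phi> h'"
    and bdd: "bdd_below (\<phi> ` {0<..1})"
  shows "(\<phi> \<longlongrightarrow> (INF h\<in>{0<..1}. \<phi> h)) (at_right 0)"
proof (rule decreasing_tendsto)
  show "\<forall>\<^sub>F h in at_right 0. (INF h\<in>{0<..1}. \<phi> h) \<le> \<phi> h"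
    unfolding eventually_at_right_field
    using bdd by (intro exI[of _ 1]) (auto intro!: cINF_lower)
next
  fix x assume "(INF h\<in>{0<..1}. \<phi> h) < x"
  then obtain h0 where h0: "h0 \<in> {0<..1}" "\<phi> h0 < x"
    using bdd by (subst (asm) cINF_less_iff) auto
  then have "\<phi> h < x" if "0 < h" "h < h0" for h
    using mono[of h h0] that by auto
  then show "\<forall>\<^sub>F h in at_right 0. \<phi> h < x"
    unfolding eventually_at_right_field using h0 by (intro exI[of _ h0]) auto
qed

text \<open>By Jensen's inequality the averaged difference quotients at the mean are non-negative. Since
  each quotient decreases as the step shrinks, it follows both that the directional derivatives at
  the mean are finite and that their average is non-negative.\<close>

lemma dir_deriv_at_mean:
  fixes X :: "'a \<Rightarrow> 'b::euclidean_space" and F :: "'b \<Rightarrow> ereal"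
  assumes D: "convex D" and F: "\<And>x. x \<in> D \<Longrightarrow> F x = ereal (f x)" and f: "convex_on D f"
    and fin: "finite (set_pmf Q)" and X: "\<And>\<omega>. \<omega> \<in> set_pmf Q \<Longrightarrow> X \<omega> \<in> D"
    and q: "q = measure_pmf.expectation Q X"
  obtains L where "\<And>\<omega>. \<omega> \<in> set_pmf Q \<Longrightarrow> dir_deriv F q (X \<omega> - q) = ereal (L \<omega>)"
    and "\<And>\<omega>. \<omega> \<in> set_pmf Q \<Longrightarrow> L \<omega> \<le> f (X \<omega>) - f q"
    and "0 \<le> measure_pmf.expectation Q L"
proof -
  have qD: "q \<in> D" unfolding q using fin D X by (intro expectation_in_convex_pmf) auto
  define \<phi> where "\<phi> \<omega> h = (f (q + h *\<^sub>R (X \<omega> - q)) - f q) / h" for \<omega> and h :: real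
  have inD: "q + h *\<^sub>R (X \<omega> - q) \<in> D" if "\<omega> \<in> set_pmf Q" "h \<in> {0<..1}" for \<omega> h
  proof -
    have "q + h *\<^sub>R (X \<omega> - q) = (1 - h) *\<^sub>R q + h *\<^sub>R X \<omega>" by (simp add: algebra_simps)
    moreover have "\<dots> \<in> D" using D X that qD by (intro convexD) auto
    ultimately show ?thesis by simp
  qed
  have mono: "\<phi> \<omega> h \<le> \<phi> \<omega> h'" if "\<omega> \<in> set_pmf Q" "0 < h" "h \<le> h'" "h' \<le> 1" for \<omega> h h'
    unfolding \<phi>_def using that inD qD f by (intro convex_on_slope_mono[of D]) auto
  \<comment> \<open>The points \<open>q + h *\<^sub>R (X \<omega> - q)\<close> have mean
    \<open>q\<close> for each step \<open>h\<close>, so Jensen's inequality applies at every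
    scale.\<close>
  have avg: "0 \<le> (\<Sum>\<omega>\<in>set_pmf Q. pmf Q \<omega> * \<phi> \<omega> h)" if h: "h \<in> {0<..1}" for h
  proof -
    have "measure_pmf.expectation Q (\<lambda>\<omega>. q + h *\<^sub>R (X \<omega> - q)) = q"
      by (simp add: integrable_measure_pmf_finite[OF fin] q)
    moreover have "f (measure_pmf.expectation Q (\<lambda>\<omega>. q + h *\<^sub>R (X \<omega> - q))) \<le>
        measure_pmf.expectation Q (\<lambda>\<omega>. f (q + h *\<^sub>R (X \<omega> - q)))"
      using fin f inD h by (intro jensen_pmf)
    ultimately have "f q \<le> measure_pmf.expectation Q (\<lambda>\<omega>. f (q + h *\<^sub>R (X \<omega> - q)))"
      by simp
    then have "0 \<le> measure_pmf.expectation Q (\<lambda>\<omega>. \<phi> \<omega> h)"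
      using h by (simp add: \<phi>_def integrable_measure_pmf_finite[OF fin])
    then show ?thesis using fin by (simp add: expectation_finite_pmf)
  qed
  \<comment> \<open>Isolate one outcome in the non-negative average. The quotients of the others are
    at most their values at step 1, which leaves a lower bound for this one that does not depend on
    \<open>h\<close>.\<close>
  have bdd: "bdd_below (\<phi> \<omega> ` {0<..1})" if w: "\<omega> \<in> set_pmf Q" for \<omega>
  proof (rule bdd_belowI2)
    fix h :: real assume h: "h \<in> {0<..1}"
    have "0 \<le> pmf Q \<omega> * \<phi> \<omega> h + (\<Sum>\<omega>'\<in>set_pmf Q - {\<omega>}. pmf Q \<omega>' * \<phi> \<omega>' h)"
      using avg[OF h] w fin by (simp add: sum.remove)
    also have "\<dots> \<le> pmf Q \<omega> * \<phi> \<omega> h + (\<Sum>\<omega>'\<in>set_pmf Q - {\<omega>}. pmf Q \<omega>' * \<phi> \<omega>' 1)"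
      using h mono by (intro add_left_mono sum_mono mult_left_mono) auto
    finally have "- (\<Sum>\<omega>'\<in>set_pmf Q - {\<omega>}. pmf Q \<omega>' * \<phi> \<omega>' 1) \<le> \<phi> \<omega> h * pmf Q \<omega>"
      by (simp add: mult.commute)
    then show "- (\<Sum>\<omega>'\<in>set_pmf Q - {\<omega>}. pmf Q \<omega>' * \<phi> \<omega>' 1) / pmf Q \<omega> \<le> \<phi> \<omega> h"
      using w by (subst pos_divide_le_eq) (simp_all add: pmf_positive)
  qed
  define L where "L \<omega> = (INF h\<in>{0<..1}. \<phi> \<omega> h)" for \<omega>
  have lim: "(\<phi> \<omega> \<longlongrightarrow> L \<omega>) (at_right 0)" if "\<omega> \<in> set_pmf Q" for \<omega>
    unfolding L_def using that mono bdd by (intro mono_tendsto_at_right_INF) auto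
  have dd: "dir_deriv F q (X \<omega> - q) = ereal (L \<omega>)" if "\<omega> \<in> set_pmf Q" for \<omega>
    unfolding dir_deriv_def
  proof (rule tendsto_Lim)
    have "((\<lambda>h. ereal (\<phi> \<omega> h)) \<longlongrightarrow> ereal (L \<omega>)) (at_right 0)"
      using lim[OF that] by simp
    moreover have "\<forall>\<^sub>F h in at_right 0. ereal (\<phi> \<omega> h) = (F (q + h *\<^sub>R (X \<omega> - q)) - F q) / ereal h"
      unfolding eventually_at_right_field
      using F inD[OF that] qD by (intro exI[of _ 1]) (auto simp: \<phi>_def)
    ultimately show "((\<lambda>h. (F (q + h *\<^sub>R (X \<omega> - q)) - F q) / ereal h) \<longlongrightarrow> ereal (L \<omega>)) (at_right 0)"
      by (rule Lim_transform_eventually)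
  qed simp
  have "L \<omega> \<le> \<phi> \<omega> 1" if "\<omega> \<in> set_pmf Q" for \<omega>
    unfolding L_def using bdd[OF that] by (intro cINF_lower) auto
  then have le: "L \<omega> \<le> f (X \<omega>) - f q" if "\<omega> \<in> set_pmf Q" for \<omega>
    using that by (simp add: \<phi>_def)
  have "0 \<le> (\<Sum>\<omega>\<in>set_pmf Q. pmf Q \<omega> * L \<omega>)"
  proof (rule tendsto_lowerbound)
    show "((\<lambda>h. \<Sum>\<omega>\<in>set_pmf Q. pmf Q \<omega> * \<phi> \<omega> h) \<longlongrightarrow> (\<Sum>\<omega>\<in>set_pmf Q. pmf Q \<omega> * L \<omega>)) (at_right 0)"
      by (intro tendsto_intros lim)
    show "\<forall>\<^sub>F h in at_right 0. 0 \<le> (\<Sum>\<omega>\<in>set_pmf Q. pmf Q \<omega> * \<phi> \<omega> h)"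
      unfolding eventually_at_right_field using avg by (intro exI[of _ 1]) auto
  qed simp
  then have "0 \<le> measure_pmf.expectation Q L"
    using fin by (simp add: expectation_finite_pmf)
  then show thesis using that dd le by blast
qed

text \<open>The first-order term of the divergence has non-negative average at the mean, so dropping
  it leaves the Jensen gap as an upper bound. The divergences are real here, although
  \<open>bregman\<close> takes extended-real values.\<close>

lemma expect_bregman_at_mean:
  fixes X :: "'a \<Rightarrow> 'b::euclidean_space" and F :: "'b \<Rightarrow> ereal"
  assumes D: "convex D" and F: "\<And>x. x \<in> D \<Longrightarrow> F x = ereal (f x)" and f: "convex_on D f"
    and fin: "finite (set_pmf Q)" and X: "\<And>\<omega>. \<omega> \<in> set_pmf Q \<Longrightarrow> X \<omega> \<in> D"
    and q: "q = measure_pmf.expectation Q X"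
  obtains g where "expect_ereal Q (\<lambda>\<omega>. bregman F (X \<omega>) q) = ereal g"
    and "0 \<le> g" and "g \<le> measure_pmf.expectation Q (\<lambda>\<omega>. f (X \<omega>)) - f q"
proof -
  note integ = integrable_measure_pmf_finite[OF fin]
  have qD: "q \<in> D" unfolding q using fin D X by (intro expectation_in_convex_pmf) auto
  have jensen: "f q \<le> measure_pmf.expectation Q (\<lambda>\<omega>. f (X \<omega>))"
    unfolding q using fin f X by (intro jensen_pmf)
  \<comment> \<open>\<open>L\<close> is the first-order term: the gradient paired with the
    displacement where \<open>F\<close> is differentiable at \<open>q\<close>, the directional
    derivative otherwise. In the first case it averages to exactly 0; in the second only the sign of
    the average is known.\<close>
  obtain L where L: "\<And>\<omega>. \<omega> \<in> set_pmf Q \<Longrightarrow> bregman F (X \<omega>) q = ereal (f (X \<omega>) - f q - L \<omega>)"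
    and EL: "0 \<le> measure_pmf.expectation Q L"
    and nonneg: "0 \<le> measure_pmf.expectation Q (\<lambda>\<omega>. f (X \<omega>) - f q - L \<omega>)"
  proof (cases "\<exists>g. has_grad F q g")
    case True
    have E: "measure_pmf.expectation Q (\<lambda>\<omega>. inner (grad F q) (X \<omega> - q)) = 0"
      by (simp add: integ q)
    show thesis
    proof (rule that[of "\<lambda>\<omega>. inner (grad F q) (X \<omega> - q)"])
      show "0 \<le> measure_pmf.expectation Q (\<lambda>\<omega>. f (X \<omega>) - f q - inner (grad F q) (X \<omega> - q))"
        using jensen E by (simp add: integ)
    qed (use True F X qD E in \<open>auto simp: bregman_def\<close>)
  next
    case False
    obtain L where dd: "\<And>\<omega>. \<omega> \<in> set_pmf Q \<Longrightarrow> dir_deriv F q (X \<omega> - q) = ereal (L \<omega>)"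
      and le: "\<And>\<omega>. \<omega> \<in> set_pmf Q \<Longrightarrow> L \<omega> \<le> f (X \<omega>) - f q"
      and EL: "0 \<le> measure_pmf.expectation Q L"
      using dir_deriv_at_mean[OF D F f fin X q] by metis
    show thesis
    proof (rule that[of L])
      show "0 \<le> measure_pmf.expectation Q (\<lambda>\<omega>. f (X \<omega>) - f q - L \<omega>)"
        using le by (intro expectation_nonneg_pmf) auto
    qed (use False F X qD dd EL in \<open>auto simp: bregman_def\<close>)
  qed
  let ?g = "measure_pmf.expectation Q (\<lambda>\<omega>. f (X \<omega>) - f q - L \<omega>)"
  have "expect_ereal Q (\<lambda>\<omega>. bregman F (X \<omega>) q) = ereal ?g"
    using fin L by (simp add: expect_ereal_def expectation_finite_pmf sum_ereal)
  moreover have "?g \<le> measure_pmf.expectation Q (\<lambda>\<omega>. f (X \<omega>)) - f q"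
    using EL by (simp add: integ)
  ultimately show thesis using that nonneg by blast
qed


section \<open>Histories and posteriors\<close>

text \<open>An entry of the past can be moved from the history into the policy. What follows the
  first round is thus again play from the empty history, which is what an induction over rounds
  needs.\<close>

lemma play_from_Cons_history:
  "play_from \<Phi> \<pi> (x # h) zs = map_pmf ((#) x) (play_from \<Phi> (\<lambda>h. \<pi> (x # h)) h zs)"
  by (induction zs arbitrary: h) (simp_all add: map_bind_pmf)

lemma actions_law_Nil: "actions_law \<Phi> \<pi> [] = return_pmf []"
  by (simp add: actions_law_def)

lemma actions_law_Cons:
  "actions_law \<Phi> \<pi> (z # zs) =
    bind_pmf (\<pi> []) (\<lambda>a. map_pmf ((#) a) (actions_law \<Phi> (\<lambda>h. \<pi> ((a, \<Phi> a z) # h)) zs))"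
  by (simp add: actions_law_def play_from_Cons_history map_bind_pmf pmf.map_comp o_def)

lemma is_policy_Nil: "is_policy A \<Sigma> \<pi> \<Longrightarrow> set_pmf (\<pi> []) \<subseteq> A"
  by (simp add: is_policy_def)

lemma is_policy_Cons:
  "is_policy A \<Sigma> \<pi> \<Longrightarrow> a \<in> A \<Longrightarrow> s \<in> \<Sigma> \<Longrightarrow> is_policy A \<Sigma> (\<lambda>h. \<pi> ((a, s) # h))"
  by (auto simp: is_policy_def)

text \<open>A policy is constrained only on histories over \<open>A\<close> and \<Sigma>. That the
  actions stay in \<open>A\<close> therefore has to be carried along the play together with the
  signals staying in \<Sigma>.\<close>

lemma set_actions_law:
  assumes "\<And>a z. a \<in> A \<Longrightarrow> z \<in> Z \<Longrightarrow> \<Phi> a z \<in> \<Sigma>" "is_policy A \<Sigma> \<pi>" "set zs \<subseteq> Z"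
  shows "set_pmf (actions_law \<Phi> \<pi> zs) \<subseteq> {as. length as = length zs \<and> set as \<subseteq> A}"
  using assms(2,3)
proof (induction zs arbitrary: \<pi>)
  case (Cons z zs)
  have "set_pmf (actions_law \<Phi> (\<lambda>h. \<pi> ((a, \<Phi> a z) # h)) zs) \<subseteq> {as. length as = length zs \<and> set as \<subseteq> A}"
    if "a \<in> set_pmf (\<pi> [])" for a
    using is_policy_Nil[OF Cons.prems(1)] that Cons.prems assms(1)
    by (intro Cons.IH is_policy_Cons) auto
  then show ?case
    using is_policy_Nil[OF Cons.prems(1)] by (fastforce simp: actions_law_Cons)
qed (simp add: actions_law_Nil)

lemma finite_actions_law:
  assumes "finite A" "\<And>a z. a \<in> A \<Longrightarrow> z \<in> Z \<Longrightarrow> \<Phi> a z \<in> \<Sigma>" "is_policy A \<Sigma> \<pi>" "set zs \<subseteq> Z"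
  shows "finite (set_pmf (actions_law \<Phi> \<pi> zs))"
  using finite_subset[OF set_actions_law[OF assms(2-4)]] finite_lists_length_eq[OF assms(1), of "length zs"]
  by (simp add: conj_commute)

text \<open>The payoff \<open>g\<close> is left open in order to treat two quantities alike: the
  regret against a fixed comparator and the total of \<beta>.\<close>

definition expected_total ::
  "('a \<Rightarrow> 'z \<Rightarrow> 's) \<Rightarrow> ('a, 's) policy \<Rightarrow> ('z \<Rightarrow> 'a \<Rightarrow> real) \<Rightarrow> 'z list \<Rightarrow> real" where
  "expected_total \<Phi> \<pi> g zs =
     measure_pmf.expectation (actions_law \<Phi> \<pi> zs) (\<lambda>as. \<Sum>t<length zs. g (zs ! t) (as ! t))"

lemma expected_total_Nil [simp]: "expected_total \<Phi> \<pi> g [] = 0"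
  by (simp add: expected_total_def)

lemma expected_total_Cons:
  assumes A: "finite A" and signals: "\<And>a z. a \<in> A \<Longrightarrow> z \<in> Z \<Longrightarrow> \<Phi> a z \<in> \<Sigma>"
    and pi: "is_policy A \<Sigma> \<pi>" and zs: "z \<in> Z" "set zs \<subseteq> Z"
  shows "expected_total \<Phi> \<pi> g (z # zs) =
    measure_pmf.expectation (\<pi> []) (\<lambda>a. g z a + expected_total \<Phi> (\<lambda>h. \<pi> ((a, \<Phi> a z) # h)) g zs)"
proof -
  have fin: "finite (set_pmf (actions_law \<Phi> (\<lambda>h. \<pi> ((a, \<Phi> a z) # h)) zs))" if "a \<in> set_pmf (\<pi> [])" for a
    using is_policy_Nil[OF pi] that assms by (intro finite_actions_law[of A Z \<Phi> \<Sigma>] is_policy_Cons) auto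
  have "finite (set_pmf (\<pi> []))"
    using is_policy_Nil[OF pi] A finite_subset by blast
  then have "expected_total \<Phi> \<pi> g (z # zs) = measure_pmf.expectation (\<pi> []) (\<lambda>a.
      measure_pmf.expectation (actions_law \<Phi> (\<lambda>h. \<pi> ((a, \<Phi> a z) # h)) zs)
        (\<lambda>as. g z a + (\<Sum>t<length zs. g (zs ! t) (as ! t))))"
    using fin unfolding expected_total_def actions_law_Cons
    by (subst expectation_bind_finite_pmf) (auto simp: sum.lessThan_Suc_shift simp del: sum.lessThan_Suc)
  also have "\<dots> = measure_pmf.expectation (\<pi> [])
      (\<lambda>a. g z a + expected_total \<Phi> (\<lambda>h. \<pi> ((a, \<Phi> a z) # h)) g zs)"
    unfolding expected_total_def
    by (intro expectation_cong_pmf) (simp add: fin integrable_measure_pmf_finite)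
  finally show ?thesis .
qed

lemma expected_total_nonneg:
  assumes "\<And>a z. a \<in> A \<Longrightarrow> z \<in> Z \<Longrightarrow> \<Phi> a z \<in> \<Sigma>" "is_policy A \<Sigma> \<pi>" "set zs \<subseteq> Z"
    and g: "\<And>z a. z \<in> Z \<Longrightarrow> a \<in> A \<Longrightarrow> 0 \<le> g z a"
  shows "0 \<le> expected_total \<Phi> \<pi> g zs"
  unfolding expected_total_def
proof (intro expectation_nonneg_pmf sum_nonneg)
  fix as t assume "as \<in> set_pmf (actions_law \<Phi> \<pi> zs)" "t \<in> {..<length zs}"
  then have "as ! t \<in> A" "zs ! t \<in> Z"
    using set_actions_law[of A Z \<Phi> \<Sigma>, OF assms(1-3)] assms(3) by (force dest: nth_mem)+
  then show "0 \<le> g (zs ! t) (as ! t)" by (intro g)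
qed

section \<open>Conditioning on the observation of the first round\<close>

text \<open>Here \<rho> is a joint law of a latent sequence and a comparator; this marginal is the
  law \<nu> to which the information ratio is applied.\<close>

definition first_round :: "('z list \<times> 'a) pmf \<Rightarrow> ('z \<times> 'a) pmf" where
  "first_round \<rho> = map_pmf (\<lambda>(zs, b). (hd zs, b)) \<rho>"

definition observe :: "('a \<Rightarrow> 'z \<Rightarrow> 's) \<Rightarrow> ('z list \<times> 'b) \<times> 'a \<Rightarrow> 'a \<times> 's" where
  "observe \<Phi> = (\<lambda>((zs, b), a). (a, \<Phi> a (hd zs)))"

text \<open>The posterior given the first action and signal. The latent of that round is dropped
  while the comparator is kept, so the result has the same shape as \<rho> with one round
  fewer.\<close>

definition later_rounds ::
  "('a \<Rightarrow> 'z \<Rightarrow> 's) \<Rightarrow> ('z list \<times> 'b) pmf \<Rightarrow> 'a pmf \<Rightarrow> 'a \<times> 's \<Rightarrow> ('z list \<times> 'b) pmf" where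
  "later_rounds \<Phi> \<rho> p x =
     map_pmf (\<lambda>((zs, b), a). (tl zs, b)) (cond_pmf (pair_pmf \<rho> p) {\<omega>. observe \<Phi> \<omega> = x})"

text \<open>The conditioning event in \<open>posterior_mean\<close> pulls back to the event that
  \<open>observe\<close> returns \<open>(a, s)\<close>. The hypothesis makes this event meet the
  support, so that \<open>cond_pmf\<close> is a genuine conditional law.\<close>

lemma posterior_mean_first_round:
  assumes "(a, s) \<in> set_pmf (map_pmf (observe \<Phi>) (pair_pmf \<rho> p))"
  shows "posterior_mean \<Phi> (first_round \<rho>) p a s = measure_pmf.expectation (later_rounds \<Phi> \<rho> p (a, s)) snd"
proof -
  let ?f = "\<lambda>((zs, b), a). ((hd zs, b), a)" and ?S = "{((z, b), a'). a' = a \<and> \<Phi> a' z = s}"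
  have vim: "?f -` ?S = {\<omega>. observe \<Phi> \<omega> = (a, s)}"
    by (auto simp: observe_def)
  have "pair_pmf (first_round \<rho>) p = map_pmf ?f (pair_pmf \<rho> p)"
    by (auto simp: first_round_def pair_map_pmf1 intro!: map_pmf_cong)
  moreover have "set_pmf (pair_pmf \<rho> p) \<inter> ?f -` ?S \<noteq> {}"
    unfolding vim using assms by auto
  ultimately show ?thesis
    by (simp add: posterior_mean_def later_rounds_def cond_map_pmf vim observe_def case_prod_beta)
qed

lemma set_later_rounds:
  assumes "x \<in> set_pmf (map_pmf (observe \<Phi>) (pair_pmf \<rho> p))"
    and "set_pmf \<rho> \<subseteq> latent_seqs Z (Suc k) \<times> D"
  shows "set_pmf (later_rounds \<Phi> \<rho> p x) \<subseteq> latent_seqs Z k \<times> D"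
proof -
  have "set_pmf (pair_pmf \<rho> p) \<inter> {\<omega>. observe \<Phi> \<omega> = x} \<noteq> {}"
    using assms(1) by auto
  moreover have "tl zs \<in> latent_seqs Z k" if "zs \<in> latent_seqs Z (Suc k)" for zs
    using that by (cases zs) (auto simp: latent_seqs_def)
  ultimately show ?thesis
    using assms(2) by (auto simp: later_rounds_def set_cond_pmf)
qed

lemma finite_later_rounds:
  assumes "x \<in> set_pmf (map_pmf (observe \<Phi>) (pair_pmf \<rho> p))"
    and "finite (set_pmf \<rho>)" "finite (set_pmf p)"
  shows "finite (set_pmf (later_rounds \<Phi> \<rho> p x))"
proof -
  have "set_pmf (pair_pmf \<rho> p) \<inter> {\<omega>. observe \<Phi> \<omega> = x} \<noteq> {}"
    using assms(1) by auto
  then show ?thesis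
    using assms(2,3) by (simp add: later_rounds_def set_cond_pmf)
qed

text \<open>Tower property for the first observation. The integrand \<open>G\<close> may depend on
  the observation, because that is constant on the conditioning event.\<close>

lemma expectation_later_rounds:
  fixes G :: "'a \<times> 's \<Rightarrow> 'z list \<times> 'b \<Rightarrow> 'c::euclidean_space"
  assumes "finite (set_pmf \<rho>)" "finite (set_pmf p)"
  shows "measure_pmf.expectation (map_pmf (observe \<Phi>) (pair_pmf \<rho> p))
      (\<lambda>x. measure_pmf.expectation (later_rounds \<Phi> \<rho> p x) (G x)) =
    measure_pmf.expectation (pair_pmf \<rho> p) (\<lambda>((zs, b), a). G (a, \<Phi> a (hd zs)) (tl zs, b))"
    (is "?lhs = measure_pmf.expectation ?Q ?h")
proof -
  have "measure_pmf.expectation (later_rounds \<Phi> \<rho> p x) (G x) =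
      measure_pmf.expectation (cond_pmf ?Q {\<omega>. observe \<Phi> \<omega> = x}) ?h"
    if "x \<in> set_pmf (map_pmf (observe \<Phi>) ?Q)" for x
  proof -
    have "set_pmf ?Q \<inter> {\<omega>. observe \<Phi> \<omega> = x} \<noteq> {}"
      using that by auto
    then show ?thesis
      unfolding later_rounds_def integral_map_pmf
      by (intro expectation_cong_pmf) (auto simp: set_cond_pmf observe_def)
  qed
  then have "?lhs = measure_pmf.expectation (map_pmf (observe \<Phi>) ?Q)
      (\<lambda>x. measure_pmf.expectation (cond_pmf ?Q {\<omega>. observe \<Phi> \<omega> = x}) ?h)"
    by (rule expectation_cong_pmf)
  also have "\<dots> = measure_pmf.expectation ?Q ?h"
    using assms by (intro expectation_cond_pmf) auto
  finally show ?thesis .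
qed


section \<open>Playing against the posterior\<close>

text \<open>The first action is drawn independently of the latent sequence and the comparator, which
  gives the product law; the continuation is then regrouped by what was observed. The payoff may
  depend on the comparator, as it does for the regret.\<close>

lemma expected_total_later_rounds:
  fixes g :: "'a::euclidean_space \<Rightarrow> 'z \<Rightarrow> 'a \<Rightarrow> real"
  assumes A: "finite A" and signals: "\<And>a z. a \<in> A \<Longrightarrow> z \<in> Z \<Longrightarrow> \<Phi> a z \<in> \<Sigma>"
    and pi: "is_policy A \<Sigma> \<pi>" and fin: "finite (set_pmf \<rho>)"
    and rho: "set_pmf \<rho> \<subseteq> latent_seqs Z (Suc k) \<times> D"
  shows "measure_pmf.expectation \<rho> (\<lambda>(zs, b). expected_total \<Phi> \<pi> (g b) zs) =
    measure_pmf.expectation (pair_pmf (first_round \<rho>) (\<pi> [])) (\<lambda>((z, b), a). g b z a) +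
    measure_pmf.expectation (map_pmf (observe \<Phi>) (pair_pmf \<rho> (\<pi> [])))
      (\<lambda>x. measure_pmf.expectation (later_rounds \<Phi> \<rho> (\<pi> []) x)
        (\<lambda>(zs, b). expected_total \<Phi> (\<lambda>h. \<pi> (x # h)) (g b) zs))"
proof -
  have finp: "finite (set_pmf (\<pi> []))"
    using is_policy_Nil[OF pi] A finite_subset by blast
  have finQ: "finite (set_pmf (pair_pmf \<rho> (\<pi> [])))"
    using fin finp by simp
  let ?tot = "\<lambda>a s. expected_total \<Phi> (\<lambda>h. \<pi> ((a, s) # h))"
  have step: "expected_total \<Phi> \<pi> (g b) zs =
      measure_pmf.expectation (\<pi> []) (\<lambda>a. g b (hd zs) a + ?tot a (\<Phi> a (hd zs)) (g b) (tl zs))"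
    if "(zs, b) \<in> set_pmf \<rho>" for zs b
  proof -
    have zs: "length zs = Suc k" "set zs \<subseteq> Z" using that rho by (auto simp: latent_seqs_def)
    then obtain z zs' where "zs = z # zs'" by (cases zs) auto
    then show ?thesis
      using zs expected_total_Cons[of A Z \<Phi> \<Sigma> \<pi> z zs' "g b"] A signals pi by simp
  qed
  have "measure_pmf.expectation \<rho> (\<lambda>(zs, b). expected_total \<Phi> \<pi> (g b) zs) =
      measure_pmf.expectation (pair_pmf \<rho> (\<pi> []))
        (\<lambda>((zs, b), a). g b (hd zs) a + ?tot a (\<Phi> a (hd zs)) (g b) (tl zs))"
    unfolding expectation_pair_finite_pmf[OF fin finp]
    using step by (intro expectation_cong_pmf) (auto simp: case_prod_beta')
  also have "\<dots> = measure_pmf.expectation (pair_pmf \<rho> (\<pi> [])) (\<lambda>((zs, b), a). g b (hd zs) a) +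
      measure_pmf.expectation (pair_pmf \<rho> (\<pi> []))
        (\<lambda>((zs, b), a). ?tot a (\<Phi> a (hd zs)) (g b) (tl zs))"
    unfolding case_prod_beta'
    by (intro Bochner_Integration.integral_add integrable_measure_pmf_finite[OF finQ])
  also have "measure_pmf.expectation (pair_pmf \<rho> (\<pi> []))
        (\<lambda>((zs, b), a). ?tot a (\<Phi> a (hd zs)) (g b) (tl zs)) =
      measure_pmf.expectation (map_pmf (observe \<Phi>) (pair_pmf \<rho> (\<pi> [])))
      (\<lambda>x. measure_pmf.expectation (later_rounds \<Phi> \<rho> (\<pi> []) x)
        (\<lambda>(zs, b). expected_total \<Phi> (\<lambda>h. \<pi> (x # h)) (g b) zs))"
    by (subst expectation_later_rounds[OF fin finp]) (simp add: case_prod_beta')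
  also have "measure_pmf.expectation (pair_pmf \<rho> (\<pi> [])) (\<lambda>((zs, b), a). g b (hd zs) a) =
      measure_pmf.expectation (pair_pmf (first_round \<rho>) (\<pi> [])) (\<lambda>((z, b), a). g b z a)"
    by (simp add: first_round_def pair_map_pmf1 case_prod_beta')
  finally show ?thesis .
qed

text \<open>The information ratio with its divergence term replaced by the expected increase of
  \<open>f\<close> from the prior mean to the posterior mean. Unlike the divergence, this increase
  telescopes over the rounds.\<close>

lemma exists_first_action:
  fixes F :: "'a::euclidean_space \<Rightarrow> ereal"
  assumes A: "finite A" and D: "convex D" and F: "\<And>x. x \<in> D \<Longrightarrow> F x = ereal (f x)"
    and f: "convex_on D f" and lam: "1 < lam"
    and ratio: "adaptive_info_ratio A Z \<Phi> loss D F \<alpha> \<beta> lam"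
    and fin: "finite (set_pmf \<rho>)" and rho: "set_pmf \<rho> \<subseteq> latent_seqs Z (Suc k) \<times> D"
  obtains p where "set_pmf p \<subseteq> A"
    and "0 \<le> measure_pmf.expectation (map_pmf (observe \<Phi>) (pair_pmf \<rho> p))
      (\<lambda>x. f (measure_pmf.expectation (later_rounds \<Phi> \<rho> p x) snd)) - f (measure_pmf.expectation \<rho> snd)"
    and "measure_pmf.expectation (pair_pmf (first_round \<rho>) p) (\<lambda>((z, b), a). inner (a - b) (loss z))
      \<le> \<alpha> + measure_pmf.expectation (pair_pmf (first_round \<rho>) p) (\<lambda>((z, b), a). \<beta> z a) powr (1 - 1 / lam) *
        (measure_pmf.expectation (map_pmf (observe \<Phi>) (pair_pmf \<rho> p))
          (\<lambda>x. f (measure_pmf.expectation (later_rounds \<Phi> \<rho> p x) snd)) -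
            f (measure_pmf.expectation \<rho> snd)) powr (1 / lam)"
proof -
  have "set_pmf (first_round \<rho>) \<subseteq> Z \<times> D"
  proof (clarsimp simp: first_round_def)
    fix zs b assume "(zs, b) \<in> set_pmf \<rho>"
    then have "(zs, b) \<in> latent_seqs Z (Suc k) \<times> D" using rho by blast
    then show "hd zs \<in> Z \<and> b \<in> D" by (cases zs) (auto simp: latent_seqs_def)
  qed
  moreover have "finite (set_pmf (first_round \<rho>))"
    using fin by (simp add: first_round_def)
  ultimately obtain p where p: "set_pmf p \<subseteq> A"
    and bound: "ereal (measure_pmf.expectation (pair_pmf (first_round \<rho>) p) (\<lambda>((z, b), a). inner (a - b) (loss z)))
      \<le> ereal \<alpha> +
        ereal (measure_pmf.expectation (pair_pmf (first_round \<rho>) p) (\<lambda>((z, b), a). \<beta> z a) powr (1 - 1 / lam)) *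
        ereal_powr (expected_gain F \<Phi> (first_round \<rho>) p) (1 / lam)"
    using ratio unfolding adaptive_info_ratio_def by blast
  have finp: "finite (set_pmf p)" using p A finite_subset by blast
  define L where "L = map_pmf (observe \<Phi>) (pair_pmf \<rho> p)"
  define m where "m x = measure_pmf.expectation (later_rounds \<Phi> \<rho> p x) snd" for x
  have finL: "finite (set_pmf L)" using fin finp by (simp add: L_def)
  have mD: "m x \<in> D" if "x \<in> set_pmf L" for x
    unfolding m_def using that fin finp D set_later_rounds[of x \<Phi> \<rho> p Z k D] rho
    by (intro expectation_in_convex_pmf finite_later_rounds) (auto simp: L_def)
  \<comment> \<open>The posterior means average to the prior mean, as the Bregman estimate requires
    of its base point.\<close>
  have mean: "measure_pmf.expectation \<rho> snd = measure_pmf.expectation L m"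
  proof -
    have "measure_pmf.expectation L m = measure_pmf.expectation (pair_pmf \<rho> p) (\<lambda>((zs, b), a). b)"
      unfolding L_def m_def by (subst expectation_later_rounds[OF fin finp]) (simp add: case_prod_beta')
    also have "\<dots> = measure_pmf.expectation \<rho> snd"
      using expectation_pair_pmf_fst[of \<rho> p snd] by (simp add: case_prod_beta')
    finally show ?thesis ..
  qed
  \<comment> \<open>The observation depends on the sequence only through its first latent, so it can
    be read off the marginal \<open>first_round\<close>, on which \<open>expected_gain\<close> is
    defined.\<close>
  define out where "out = (\<lambda>((z, b :: 'a), a). (a, \<Phi> a z))"
  have Lset: "map_pmf out (pair_pmf (first_round \<rho>) p) = L"
    by (simp add: L_def out_def first_round_def pair_map_pmf1 pmf.map_comp observe_def o_def case_prod_beta')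
  define Q where "Q = pair_pmf (first_round \<rho>) p"
  define X where "X = (\<lambda>\<omega>. m (out \<omega>))"
  have EX: "measure_pmf.expectation L h = measure_pmf.expectation Q (\<lambda>\<omega>. h (out \<omega>))"
    for h :: "_ \<Rightarrow> 'v::euclidean_space"
    by (simp add: Q_def flip: Lset)
  have obs: "out \<omega> \<in> set_pmf L" if "\<omega> \<in> set_pmf Q" for \<omega>
    using that unfolding Lset[symmetric] set_map_pmf Q_def by (rule imageI)
  have finQ: "finite (set_pmf Q)"
    using fin finp by (simp add: Q_def first_round_def)
  obtain g where g: "expect_ereal Q (\<lambda>\<omega>. bregman F (X \<omega>) (measure_pmf.expectation \<rho> snd)) = ereal g"
    and "0 \<le> g" and le: "g \<le> measure_pmf.expectation Q (\<lambda>\<omega>. f (X \<omega>)) - f (measure_pmf.expectation \<rho> snd)"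
  proof (rule expect_bregman_at_mean[OF D F f finQ])
    show "X \<omega> \<in> D" if "\<omega> \<in> set_pmf Q" for \<omega>
      unfolding X_def using obs[OF that] by (rule mD)
    show "measure_pmf.expectation \<rho> snd = measure_pmf.expectation Q X"
      unfolding mean EX X_def ..
  qed auto
  \<comment> \<open>Since the gain is a real number, the extended-real bound of the hypothesis
    becomes one between reals.\<close>
  have "expected_gain F \<Phi> (first_round \<rho>) p = ereal g"
  proof -
    have "posterior_mean \<Phi> (first_round \<rho>) p a (\<Phi> a z) = m (a, \<Phi> a z)" if "((z, b), a) \<in> set_pmf Q" for z b a
      unfolding m_def using obs[OF that] by (intro posterior_mean_first_round) (simp add: L_def out_def)
    moreover have "measure_pmf.expectation (first_round \<rho>) snd = measure_pmf.expectation \<rho> snd"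
      by (simp add: first_round_def case_prod_beta')
    ultimately show ?thesis
      unfolding expected_gain_def g[symmetric] expect_ereal_def Q_def[symmetric]
      by (intro sum.cong) (auto simp: X_def out_def)
  qed
  then have "measure_pmf.expectation Q (\<lambda>((z, b), a). inner (a - b) (loss z))
      \<le> \<alpha> + measure_pmf.expectation Q (\<lambda>((z, b), a). \<beta> z a) powr (1 - 1 / lam) * g powr (1 / lam)"
    using bound by (simp add: ereal_powr_def Q_def)
  moreover define G where "G = measure_pmf.expectation L (\<lambda>x. f (m x)) - f (measure_pmf.expectation \<rho> snd)"
  have "g \<le> G"
    using le unfolding G_def EX X_def .
  then have "g powr (1 / lam) \<le> G powr (1 / lam)"
    using \<open>0 \<le> g\<close> lam by (intro powr_mono2) auto
  then have "measure_pmf.expectation Q (\<lambda>((z, b), a). \<beta> z a) powr (1 - 1 / lam) * g powr (1 / lam) \<le>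
      measure_pmf.expectation Q (\<lambda>((z, b), a). \<beta> z a) powr (1 - 1 / lam) * G powr (1 / lam)"
    by (intro mult_left_mono) auto
  ultimately have "measure_pmf.expectation Q (\<lambda>((z, b), a). inner (a - b) (loss z))
      \<le> \<alpha> + measure_pmf.expectation Q (\<lambda>((z, b), a). \<beta> z a) powr (1 - 1 / lam) * G powr (1 / lam)"
    by linarith
  moreover have "0 \<le> G" using \<open>0 \<le> g\<close> \<open>g \<le> G\<close> by linarith
  ultimately show thesis
    using that[OF p] unfolding Q_def G_def L_def m_def by blast
qed

text \<open>The law is joint, with the comparator as a separate component: after conditioning, the
  comparator need not be a function of the remaining latents, so this is the form that the induction
  preserves. The bound \<open>M\<close> keeps the gap at every mean in \<open>D\<close>
  non-negative.\<close>

lemma exists_policy: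
  fixes F :: "'a::euclidean_space \<Rightarrow> ereal" and \<rho> :: "('z list \<times> 'a) pmf"
  assumes A: "finite A" "A \<noteq> {}" and signals: "\<And>a z. a \<in> A \<Longrightarrow> z \<in> Z \<Longrightarrow> \<Phi> a z \<in> \<Sigma>"
    and beta: "\<And>z a. z \<in> Z \<Longrightarrow> a \<in> A \<Longrightarrow> 0 \<le> \<beta> z a"
    and D: "convex D" and F: "\<And>x. x \<in> D \<Longrightarrow> F x = ereal (f x)"
    and f: "convex_on D f" and M: "\<And>x. x \<in> D \<Longrightarrow> f x \<le> M" and lam: "1 < lam"
    and ratio: "adaptive_info_ratio A Z \<Phi> loss D F \<alpha> \<beta> lam"
    and "finite (set_pmf \<rho>)" and "set_pmf \<rho> \<subseteq> latent_seqs Z k \<times> D"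
  shows "\<exists>\<pi>. is_policy A \<Sigma> \<pi> \<and>
    measure_pmf.expectation \<rho> (\<lambda>(zs, b). expected_total \<Phi> \<pi> (\<lambda>z a. inner (a - b) (loss z)) zs) \<le>
      real k * \<alpha> +
      measure_pmf.expectation \<rho> (\<lambda>(zs, b). expected_total \<Phi> \<pi> \<beta> zs) powr (1 - 1 / lam) *
      (M - f (measure_pmf.expectation \<rho> snd)) powr (1 / lam)"
  using assms(11-)
proof (induction k arbitrary: \<rho>)
  case 0
  then have rho: "set_pmf \<rho> \<subseteq> {[]} \<times> D" by (auto simp: latent_seqs_def)
  obtain a where "a \<in> A" using A by auto
  then have "is_policy A \<Sigma> (\<lambda>_. return_pmf a)" by (simp add: is_policy_def)
  moreover have "measure_pmf.expectation \<rho> (\<lambda>(zs, b). expected_total \<Phi> \<pi> (g b) zs) =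
      measure_pmf.expectation \<rho> (\<lambda>_. 0)" for \<pi> and g :: "'a \<Rightarrow> 'z \<Rightarrow> 'a \<Rightarrow> real"
    using rho by (intro expectation_cong_pmf) auto
  ultimately show ?case by (intro exI[of _ "\<lambda>_. return_pmf a"]) simp
next
  case (Suc k)
  note fin = Suc.prems(1) and rho = Suc.prems(2)
  obtain p where p: "set_pmf p \<subseteq> A"
    and gain: "0 \<le> measure_pmf.expectation (map_pmf (observe \<Phi>) (pair_pmf \<rho> p))
      (\<lambda>x. f (measure_pmf.expectation (later_rounds \<Phi> \<rho> p x) snd)) - f (measure_pmf.expectation \<rho> snd)"
    and first: "measure_pmf.expectation (pair_pmf (first_round \<rho>) p) (\<lambda>((z, b), a). inner (a - b) (loss z))
      \<le> \<alpha> + measure_pmf.expectation (pair_pmf (first_round \<rho>) p) (\<lambda>((z, b), a). \<beta> z a) powr (1 - 1 / lam) *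
        (measure_pmf.expectation (map_pmf (observe \<Phi>) (pair_pmf \<rho> p))
          (\<lambda>x. f (measure_pmf.expectation (later_rounds \<Phi> \<rho> p x) snd)) -
            f (measure_pmf.expectation \<rho> snd)) powr (1 / lam)"
    using exists_first_action[OF A(1) D F f lam ratio Suc.prems] by metis
  have finp: "finite (set_pmf p)" using p A finite_subset by blast
  define L where "L = map_pmf (observe \<Phi>) (pair_pmf \<rho> p)"
  have finL: "finite (set_pmf L)" using fin finp by (simp add: L_def)
  define R where "R = later_rounds \<Phi> \<rho> p"
  have finR: "finite (set_pmf (R x))" if "x \<in> set_pmf L" for x
    using that fin finp by (simp add: L_def R_def finite_later_rounds del: set_map_pmf)
  have R: "set_pmf (R x) \<subseteq> latent_seqs Z k \<times> D" if "x \<in> set_pmf L" for x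
    using that rho unfolding L_def R_def by (rule set_later_rounds)
  let ?regret = "\<lambda>\<rho> \<pi>. measure_pmf.expectation \<rho>
    (\<lambda>(zs, b). expected_total \<Phi> \<pi> (\<lambda>z a. inner (a - b) (loss z)) zs)"
  let ?beta = "\<lambda>\<rho> \<pi>. measure_pmf.expectation \<rho> (\<lambda>(zs, b). expected_total \<Phi> \<pi> \<beta> zs)"
  let ?gap = "\<lambda>\<rho>. M - f (measure_pmf.expectation \<rho> snd)"
  \<comment> \<open>At observations outside the support any constant policy will do; it makes the
    choice total, as \<open>is_policy\<close> speaks of all histories over \<open>A\<close> and
    \<Sigma>.\<close>
  have "\<exists>\<pi>. is_policy A \<Sigma> \<pi> \<and> (x \<in> set_pmf L \<longrightarrow> ?regret (R x) \<pi> \<le>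
      real k * \<alpha> + ?beta (R x) \<pi> powr (1 - 1 / lam) * ?gap (R x) powr (1 / lam))" for x
  proof (cases "x \<in> set_pmf L")
    case True
    then show ?thesis using Suc.IH[OF finR R] by auto
  next
    case False
    obtain a where "a \<in> A" using A by auto
    then have "is_policy A \<Sigma> (\<lambda>_. return_pmf a)" by (simp add: is_policy_def)
    then show ?thesis using False by auto
  qed
  then obtain \<pi>' where pi': "\<And>x. is_policy A \<Sigma> (\<pi>' x)"
    and IH: "\<And>x. x \<in> set_pmf L \<Longrightarrow> ?regret (R x) (\<pi>' x) \<le>
      real k * \<alpha> + ?beta (R x) (\<pi>' x) powr (1 - 1 / lam) * ?gap (R x) powr (1 / lam)"
    by metis
  \<comment> \<open>The first observation selects the policy for its posterior, which sees only the
    history after that round.\<close>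
  define \<pi> where "\<pi> h = (case h of [] \<Rightarrow> p | x # h' \<Rightarrow> \<pi>' x h')" for h
  have pi_simps: "\<pi> [] = p" "\<And>x. (\<lambda>h. \<pi> (x # h)) = \<pi>' x" by (auto simp: \<pi>_def)
  have pi: "is_policy A \<Sigma> \<pi>"
    unfolding is_policy_def
  proof
    fix h assume "h \<in> lists (A \<times> \<Sigma>)"
    then show "set_pmf (\<pi> h) \<subseteq> A"
      using p pi' by (cases h) (simp_all add: \<pi>_def is_policy_def)
  qed
  have total: "measure_pmf.expectation \<rho> (\<lambda>(zs, b). expected_total \<Phi> \<pi> (g b) zs) =
      measure_pmf.expectation (pair_pmf (first_round \<rho>) p) (\<lambda>((z, b), a). g b z a) +
      measure_pmf.expectation L (\<lambda>x. measure_pmf.expectation (R x)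
        (\<lambda>(zs, b). expected_total \<Phi> (\<pi>' x) (g b) zs))" for g
    using expected_total_later_rounds[OF A(1) signals pi fin rho, where g = g]
    unfolding pi_simps L_def R_def .
  define B where "B = measure_pmf.expectation (pair_pmf (first_round \<rho>) p) (\<lambda>((z, b), a). \<beta> z a)"
  define J where "J = measure_pmf.expectation L (\<lambda>x. f (measure_pmf.expectation (R x) snd)) - f (measure_pmf.expectation \<rho> snd)"
  have "?regret \<rho> \<pi> \<le> (\<alpha> + B powr (1 - 1 / lam) * J powr (1 / lam)) +
      measure_pmf.expectation L (\<lambda>x. ?regret (R x) (\<pi>' x))"
    using first total[of "\<lambda>b z a. inner (a - b) (loss z)"]
    unfolding B_def J_def L_def R_def by linarith
  also have "measure_pmf.expectation L (\<lambda>x. ?regret (R x) (\<pi>' x)) \<le> measure_pmf.expectation L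
      (\<lambda>x. real k * \<alpha> + ?beta (R x) (\<pi>' x) powr (1 - 1 / lam) * ?gap (R x) powr (1 / lam))"
    using finL IH by (intro expectation_mono_pmf)
  also have "\<dots> = real k * \<alpha> + measure_pmf.expectation L
      (\<lambda>x. ?beta (R x) (\<pi>' x) powr (1 - 1 / lam) * ?gap (R x) powr (1 / lam))"
    by (simp add: integrable_measure_pmf_finite[OF finL])
  finally have "?regret \<rho> \<pi> \<le> real (Suc k) * \<alpha> + (B powr (1 - 1 / lam) * J powr (1 / lam) +
      measure_pmf.expectation L (\<lambda>x. ?beta (R x) (\<pi>' x) powr (1 - 1 / lam) * ?gap (R x) powr (1 / lam)))"
    by (simp add: algebra_simps)
  \<comment> \<open>The first round is the additional atom, with \<open>B\<close> and
    \<open>J\<close> as its two factors; the posteriors supply the averaged products.\<close>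
  also have "B powr (1 - 1 / lam) * J powr (1 / lam) +
      measure_pmf.expectation L (\<lambda>x. ?beta (R x) (\<pi>' x) powr (1 - 1 / lam) * ?gap (R x) powr (1 / lam)) \<le>
      (B + measure_pmf.expectation L (\<lambda>x. ?beta (R x) (\<pi>' x))) powr (1 - 1 / lam) *
      (J + measure_pmf.expectation L (\<lambda>x. ?gap (R x))) powr (1 / lam)"
  proof (rule Hoelder_add_pmf[OF finL])
    show "0 \<le> B"
      unfolding B_def
    proof (rule expectation_nonneg_pmf, clarsimp simp: first_round_def)
      fix a zs b assume "a \<in> set_pmf p" "(zs, b) \<in> set_pmf \<rho>"
      then have "a \<in> A" and "(zs, b) \<in> latent_seqs Z (Suc k) \<times> D" using p rho by auto
      then show "0 \<le> \<beta> (hd zs) a" by (cases zs) (auto simp: latent_seqs_def intro: beta)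
    qed
    show "0 \<le> J" using gain by (simp add: J_def L_def R_def)
    show "0 \<le> ?beta (R x) (\<pi>' x)" if "x \<in> set_pmf L" for x
    proof (rule expectation_nonneg_pmf, clarify)
      fix zs b assume "(zs, b) \<in> set_pmf (R x)"
      then have "set zs \<subseteq> Z" using R[OF that] by (auto simp: latent_seqs_def)
      then show "0 \<le> expected_total \<Phi> (\<pi>' x) \<beta> zs"
        using expected_total_nonneg[of A Z \<Phi> \<Sigma> "\<pi>' x" zs \<beta>] signals pi' beta by auto
    qed
    show "0 \<le> ?gap (R x)" if "x \<in> set_pmf L" for x
    proof -
      have "measure_pmf.expectation (R x) snd \<in> D"
        using finR[OF that] D R[OF that] by (intro expectation_in_convex_pmf) auto
      then show ?thesis using M by simp
    qed
  qed (use lam in auto)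
  also have "B + measure_pmf.expectation L (\<lambda>x. ?beta (R x) (\<pi>' x)) = ?beta \<rho> \<pi>"
    unfolding total[of "\<lambda>_. \<beta>"] B_def ..
  \<comment> \<open>The telescoping: the expected value of \<open>f\<close> at the posterior means
    cancels between \<open>J\<close> and the averaged gaps.\<close>
  also have "J + measure_pmf.expectation L (\<lambda>x. ?gap (R x)) = ?gap \<rho>"
    by (simp add: J_def integrable_measure_pmf_finite[OF finL])
  finally show ?case using pi by auto
qed


section \<open>Comparators and the Bayesian regret\<close>

text \<open>The worst-case excess loss is a supremum of linear functions with gradients bounded by
  \<open>K\<close>, hence \<open>K\<close>-Lipschitz in \<open>b\<close>, and so it attains its
  infimum on the compact set \<open>D\<close>.\<close>

lemma approx_err_attained:
  fixes loss :: "'z \<Rightarrow> 'a::euclidean_space"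
  assumes A: "finite A" "a \<in> A" and D: "compact D" "D \<noteq> {}" and Z: "Z \<noteq> {}"
    and bounded: "bounded (loss ` Z)"
  obtains b where "b \<in> D" "\<And>z. z \<in> Z \<Longrightarrow> inner (b - a) (loss z) \<le> approx_err A Z loss D"
proof -
  obtain K where K: "\<And>z. z \<in> Z \<Longrightarrow> norm (loss z) \<le> K" "0 \<le> K"
    using bounded by (force simp: bounded_pos)
  have le: "inner x (loss z) \<le> K * norm x" if "z \<in> Z" for x z
    using norm_cauchy_schwarz[of x "loss z"] K(1)[OF that]
    by (metis mult.commute mult_left_mono norm_ge_zero order_trans)
  define G where "G b = (SUP z\<in>Z. inner (b - a) (loss z))" for b
  have bdd: "bdd_above ((\<lambda>z. inner (b - a) (loss z)) ` Z)" for b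
    using le by (intro bdd_aboveI2)
  have G_le: "G x \<le> G y + K * norm (x - y)" for x y
    unfolding G_def
  proof (rule cSUP_least[OF Z])
    fix z assume z: "z \<in> Z"
    have "inner (x - a) (loss z) = inner (y - a) (loss z) + inner (x - y) (loss z)"
      by (simp add: inner_diff_left)
    also have "inner (y - a) (loss z) \<le> (SUP z\<in>Z. inner (y - a) (loss z))"
      using z bdd by (intro cSUP_upper)
    finally show "inner (x - a) (loss z) \<le> (SUP z\<in>Z. inner (y - a) (loss z)) + K * norm (x - y)"
      using le[OF z, of "x - y"] by simp
  qed
  have "K-lipschitz_on D G"
  proof (rule lipschitz_onI)
    fix x y
    show "dist (G x) (G y) \<le> K * dist x y"
      using G_le[of x y] G_le[of y x] by (simp add: dist_norm norm_minus_commute)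
  qed (rule K)
  then obtain b where b: "b \<in> D" "\<And>y. y \<in> D \<Longrightarrow> G b \<le> G y"
    using continuous_attains_inf[OF D] lipschitz_on_continuous_on by metis
  have "G b \<le> (INF b\<in>D. G b)"
    using b D by (intro cINF_greatest) auto
  also have "\<dots> \<le> approx_err A Z loss D"
    unfolding approx_err_def G_def using A by (intro Max_ge) auto
  finally have "G b \<le> approx_err A Z loss D" .
  moreover have "inner (b - a) (loss z) \<le> G b" if "z \<in> Z" for z
    unfolding G_def using that bdd by (intro cSUP_upper)
  ultimately show thesis using that[OF b(1)] by fastforce
qed

text \<open>The comparator approximates the best action in hindsight. It depends on the latent
  sequence alone, so it can be paired with the sequence before any policy is chosen.\<close>

lemma exists_comparator:
  fixes loss :: "'z \<Rightarrow> 'a::euclidean_space"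
  assumes A: "finite A" "A \<noteq> {}" and D: "compact D" "D \<noteq> {}" and Z: "Z \<noteq> {}"
    and bounded: "bounded (loss ` Z)" and signals: "\<And>a z. a \<in> A \<Longrightarrow> z \<in> Z \<Longrightarrow> \<Phi> a z \<in> \<Sigma>"
  obtains c where "\<And>zs. c zs \<in> D"
    and "\<And>\<pi> zs. is_policy A \<Sigma> \<pi> \<Longrightarrow> set zs \<subseteq> Z \<Longrightarrow> regret A \<Phi> loss \<pi> zs \<le>
      real (length zs) * approx_err A Z loss D +
      expected_total \<Phi> \<pi> (\<lambda>z a. inner (a - c zs) (loss z)) zs"
proof -
  let ?e = "approx_err A Z loss D"
  have "\<exists>b\<in>D. \<forall>z\<in>Z. inner (b - a) (loss z) \<le> ?e" if "a \<in> A" for a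
    using approx_err_attained[OF A(1) that D Z bounded] by metis
  then obtain b where b: "\<And>a. a \<in> A \<Longrightarrow> b a \<in> D"
    "\<And>a z. a \<in> A \<Longrightarrow> z \<in> Z \<Longrightarrow> inner (b a - a) (loss z) \<le> ?e"
    by metis
  \<comment> \<open>Being linear in the vector, the total loss also makes sense for points of
    \<open>D\<close> that are not actions.\<close>
  define total where "total zs a = (\<Sum>t<length zs. inner a (loss (zs ! t)))" for zs a
  have "\<exists>a\<in>A. \<forall>a'\<in>A. total zs a \<le> total zs a'" for zs
    using obtains_MIN[OF A, of "total zs"] A(1) by (metis Min_le finite_imageI image_eqI)
  then obtain best where best: "\<And>zs. best zs \<in> A" "\<And>zs a. a \<in> A \<Longrightarrow> total zs (best zs) \<le> total zs a"
    by metis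
  show thesis
  proof (rule that[of "\<lambda>zs. b (best zs)"])
    fix \<pi> zs assume pi: "is_policy A \<Sigma> \<pi>" and zs: "set zs \<subseteq> Z"
    let ?law = "actions_law \<Phi> \<pi> zs"
    have fin: "finite (set_pmf ?law)"
      using A signals pi zs by (intro finite_actions_law[of A Z \<Phi> \<Sigma>])
    \<comment> \<open>Against the best action the comparator loses at most the approximation error
      per round, and the best action does no worse than any \<open>a\<close>.\<close>
    have comparator: "total zs (b (best zs)) \<le> real (length zs) * ?e + total zs a" if "a \<in> A" for a
    proof -
      have "total zs (b (best zs)) - total zs (best zs) =
          (\<Sum>t<length zs. inner (b (best zs) - best zs) (loss (zs ! t)))"
        by (simp add: total_def sum_subtractf inner_diff_left)
      also have "\<dots> \<le> (\<Sum>t<length zs. ?e)"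
        using zs best(1) by (intro sum_mono b(2)) auto
      finally show ?thesis using best(2)[OF that, of zs] by simp
    qed
    have "measure_pmf.expectation ?law (\<lambda>as. \<Sum>t<length zs. inner (as ! t - a) (loss (zs ! t))) \<le>
        real (length zs) * ?e + expected_total \<Phi> \<pi> (\<lambda>z a. inner (a - b (best zs)) (loss z)) zs"
      if "a \<in> A" for a
    proof -
      have "measure_pmf.expectation ?law (\<lambda>as. \<Sum>t<length zs. inner (as ! t - a) (loss (zs ! t))) \<le>
        measure_pmf.expectation ?law (\<lambda>as. real (length zs) * ?e +
          (\<Sum>t<length zs. inner (as ! t - b (best zs)) (loss (zs ! t))))"
        using comparator[OF that] fin
        by (intro expectation_mono_pmf) (simp_all add: total_def sum_subtractf inner_diff_left)
      then show ?thesis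
        by (simp add: expected_total_def integrable_measure_pmf_finite[OF fin])
    qed
    then show "regret A \<Phi> loss \<pi> zs \<le> real (length zs) * ?e +
        expected_total \<Phi> \<pi> (\<lambda>z a. inner (a - b (best zs)) (loss z)) zs"
      unfolding regret_def using A by (subst Max_le_iff) auto
  qed (use b best in auto)
qed

section \<open>The bound on the Bayesian regret\<close>

lemma expectation_joint_law:
  fixes h :: "_ \<Rightarrow> real"
  assumes "finite (set_pmf \<mu>)" "\<And>zs. zs \<in> set_pmf \<mu> \<Longrightarrow> finite (set_pmf (actions_law \<Phi> \<pi> zs))"
  shows "measure_pmf.expectation (joint_law \<Phi> \<pi> \<mu>) h =
    measure_pmf.expectation \<mu> (\<lambda>zs. measure_pmf.expectation (actions_law \<Phi> \<pi> zs) (\<lambda>as. h (zs, as)))"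
  using assms by (simp add: joint_law_def expectation_bind_finite_pmf)

theorem theorem15:
  fixes A :: "(real ^ 'd) set" and \<Sigma> :: "'s set" and Z :: "'z set"
    and \<Phi> :: "real ^ 'd \<Rightarrow> 'z \<Rightarrow> 's" and loss :: "'z \<Rightarrow> real ^ 'd"
    and F :: "real ^ 'd \<Rightarrow> ereal" and D :: "(real ^ 'd) set"
    and \<alpha> :: real and \<beta> :: "'z \<Rightarrow> real ^ 'd \<Rightarrow> real" and lam :: real
    and n :: nat and \<mu> :: "'z list pmf"
  assumes signals: "\<And>a z. a \<in> A \<Longrightarrow> z \<in> Z \<Longrightarrow> \<Phi> a z \<in> \<Sigma>"
    and losses: "\<And>z i. z \<in> Z \<Longrightarrow> loss z $ i \<in> {0..1}"
    and F_legendre: "legendre F"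
    and D_sub: "D \<subseteq> convex hull A"
    and D_compact: "compact D"
    and D_convex: "convex D"
    and D_rel_interior: "rel_interior D \<noteq> {}"
    and A_finite: "finite A"
    and A_card: "1 < card A"
    and losses_unit: "\<And>a z. a \<in> A \<Longrightarrow> z \<in> Z \<Longrightarrow> inner a (loss z) \<in> {0..1}"
    and D_dom: "D \<subseteq> dom_of F"
    and diam_finite: "pot_diam F D < \<infinity>"
    and beta_nonneg: "\<And>z a. z \<in> Z \<Longrightarrow> a \<in> A \<Longrightarrow> 0 \<le> \<beta> z a"
    and lam_gt_1: "1 < lam"
    and ratio: "adaptive_info_ratio A Z \<Phi> loss D F \<alpha> \<beta> lam"
    and n_ge_1: "1 \<le> n"
    and prior_finite: "finite (set_pmf \<mu>)"
    and prior_latent: "set_pmf \<mu> \<subseteq> latent_seqs Z n"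
  shows "\<exists>\<pi>. is_policy A \<Sigma> \<pi> \<and>
    bayes_regret A \<Phi> loss \<pi> \<mu> \<le>
      real n * (approx_err A Z loss D + \<alpha>) +
      real_of_ereal (pot_diam F D) powr (1 / lam) *
      measure_pmf.expectation (joint_law \<Phi> \<pi> \<mu>)
        (\<lambda>(zs, as). \<Sum>t<n. \<beta> (zs ! t) (as ! t)) powr (1 - 1 / lam)"
proof -
  have A_ne: "A \<noteq> {}" using A_card by auto
  have D_ne: "D \<noteq> {}" using D_rel_interior rel_interior_subset by blast
  have prior: "length zs = n" "set zs \<subseteq> Z" if "zs \<in> set_pmf \<mu>" for zs
    using that prior_latent by (auto simp: latent_seqs_def)
  \<comment> \<open>Some sequence in the support of the prior has \<open>n\<close> entries in
    \<open>Z\<close>, and \<open>n\<close> is at least 1.\<close>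
  have Z_ne: "Z \<noteq> {}"
    using prior set_pmf_not_empty[of \<mu>] n_ge_1 by fastforce
  have bounded: "bounded (loss ` Z)"
  proof (rule bounded_subset[OF bounded_cbox[of 0 "\<chi> i. 1"]])
    show "loss ` Z \<subseteq> cbox 0 (\<chi> i. 1)"
      using losses by (auto simp: mem_box_cart)
  qed
  obtain c where cD: "\<And>zs. c zs \<in> D"
    and c: "\<And>\<pi> zs. is_policy A \<Sigma> \<pi> \<Longrightarrow> set zs \<subseteq> Z \<Longrightarrow> regret A \<Phi> loss \<pi> zs \<le>
      real (length zs) * approx_err A Z loss D +
      expected_total \<Phi> \<pi> (\<lambda>z a. inner (a - c zs) (loss z)) zs"
    using exists_comparator[of A D Z loss \<Phi> \<Sigma>] A_finite A_ne D_compact D_ne Z_ne bounded signals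
    by metis
  define f where "f x = real_of_ereal (F x)" for x
  have F: "F x = ereal (f x)" if "x \<in> D" for x
  proof -
    have "F x \<noteq> -\<infinity>" "F x \<noteq> \<infinity>"
      using F_legendre D_dom that by (auto simp: legendre_def proper_fun_def dom_of_def)
    then show ?thesis by (cases "F x") (auto simp: f_def)
  qed
  have f: "convex_on D f"
    using F_legendre D_convex F by (intro convex_fun_imp_convex_on[of F]) (auto simp: legendre_def)
  \<comment> \<open>The prior with each sequence paired with its comparator: the joint law for which
    the policy is built.\<close>
  define \<rho> where "\<rho> = map_pmf (\<lambda>zs. (zs, c zs)) \<mu>"
  define q where "q = measure_pmf.expectation \<rho> snd"
  have qD: "q \<in> D"
    unfolding q_def \<rho>_def using prior_finite D_convex cD by (intro expectation_in_convex_pmf) auto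
  define d where "d = real_of_ereal (pot_diam F D)"
  have diff: "F x - F y \<le> pot_diam F D" if "x \<in> D" "y \<in> D" for x y
    unfolding pot_diam_def using that by (meson SUP_upper SUP_upper2)
  \<comment> \<open>The case of equal points gives a diameter of at least 0, which excludes minus
    infinity; plus infinity is excluded by hypothesis.\<close>
  then have "pot_diam F D = ereal d"
    using diff[OF qD qD] diam_finite F[OF qD] unfolding d_def by (cases "pot_diam F D") auto
  \<comment> \<open>This makes \<open>f q + d\<close> an admissible upper bound \<open>M\<close>. At
    the prior mean \<open>q\<close> the gap \<open>M - f q\<close> is then exactly the diameter
    \<open>d\<close>.\<close>
  then have "f x \<le> f q + d" if "x \<in> D" for x
    using diff[OF that qD] F that qD by simp
  moreover have "finite (set_pmf \<rho>)" "set_pmf \<rho> \<subseteq> latent_seqs Z n \<times> D"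
    using prior_finite prior_latent cD by (auto simp: \<rho>_def)
  ultimately obtain \<pi> where pi: "is_policy A \<Sigma> \<pi>"
    and bound: "measure_pmf.expectation \<rho> (\<lambda>(zs, b). expected_total \<Phi> \<pi> (\<lambda>z a. inner (a - b) (loss z)) zs) \<le>
      real n * \<alpha> +
      measure_pmf.expectation \<rho> (\<lambda>(zs, b). expected_total \<Phi> \<pi> \<beta> zs) powr (1 - 1 / lam) *
      (f q + d - f (measure_pmf.expectation \<rho> snd)) powr (1 / lam)"
    using exists_policy[OF A_finite A_ne signals beta_nonneg D_convex F f _ lam_gt_1 ratio, where \<rho> = \<rho> and k = n and M = "f q + d"]
    by blast
  have joint: "measure_pmf.expectation (joint_law \<Phi> \<pi> \<mu>) (\<lambda>(zs, as). \<Sum>t<n. \<beta> (zs ! t) (as ! t)) =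
      measure_pmf.expectation \<mu> (\<lambda>zs. expected_total \<Phi> \<pi> \<beta> zs)"
  proof (subst expectation_joint_law)
    show "finite (set_pmf (actions_law \<Phi> \<pi> zs))" if "zs \<in> set_pmf \<mu>" for zs
      using A_finite signals pi prior(2)[OF that] by (intro finite_actions_law[of A Z \<Phi> \<Sigma>])
  qed (use prior prior_finite in \<open>auto simp: expected_total_def intro!: expectation_cong_pmf\<close>)
  have "bayes_regret A \<Phi> loss \<pi> \<mu> \<le> measure_pmf.expectation \<mu>
      (\<lambda>zs. real n * approx_err A Z loss D + expected_total \<Phi> \<pi> (\<lambda>z a. inner (a - c zs) (loss z)) zs)"
    unfolding bayes_regret_def using c[OF pi] prior prior_finite by (intro expectation_mono_pmf) auto
  also have "\<dots> = real n * approx_err A Z loss D +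
      measure_pmf.expectation \<mu> (\<lambda>zs. expected_total \<Phi> \<pi> (\<lambda>z a. inner (a - c zs) (loss z)) zs)"
    by (simp add: integrable_measure_pmf_finite[OF prior_finite])
  also have "\<dots> \<le> real n * (approx_err A Z loss D + \<alpha>) +
      d powr (1 / lam) * measure_pmf.expectation \<mu> (\<lambda>zs. expected_total \<Phi> \<pi> \<beta> zs) powr (1 - 1 / lam)"
    using bound by (simp add: \<rho>_def q_def algebra_simps)
  finally show ?thesis
    using pi by (auto simp: joint d_def)
qed

end
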